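(* Let $1\le q,p,r,s<\infty$ be real numbers such that $q\le p\le s\le r$. Then, for every Banach space $E$, $$\ell_{q,p}^{\mathrm{mid}}(E)\overset{1}{\hookrightarrow}\ell_{r,s}^{\mathrm{mid}}(E).$$ In particular, $\ell_p^{\mathrm{mid}}(E)\overset{1}{\hookrightarrow}\ell_s^{\mathrm{mid}}(E)$ whenever $1\le p\le s<\infty$.
   Context: Banach spaces are over $\mathbb K=\mathbb R$ or $\mathbb C$; $E^*$ is the topological dual of $E$. For $1\le p<\infty$, $\ell_p^w(E)$ is the space of sequences $(x_j)_{j=1}^\infty$ in $E$ with $\|(x_j)_j\|_{w,p}:=\sup_{\varphi\in B_{E^*}}(\sum_{j}|\varphi(x_j)|^p)^{1/p}<\infty$. For $1\le q,p<\infty$, a sequence $(x_j)_{j=1}^\infty$ in $E$ is mid $(q,p)$-summable if $\sum_{j=1}^\infty\left(\sum_{n=1}^\infty|x_n^*(x_j)|^p\right)^{q/p}<\infty$ for every $(x_n^* )_{n=1}^\infty\in\ell_p^w(E^* )$. The space of all such sequences is $\ell_{q,p}^{\mathrm{mid}}(E)$, with norm $$\|(x_j)_{j=1}^\infty\|_{q,p}:=\sup_{(x_n^* )_n\in B_{\ell_p^w(E^* )}}\left(\sum_{j=1}^\infty\left(\sum_{n=1}^\infty|x_n^*(x_j)|^p\right)^{q/p}\right)^{1/q}.$$ Also $\ell_p^{\mathrm{mid}}(E):=\ell_{p,p}^{\mathrm{mid}}(E)$ with the norm $\|\cdot\|_{p,p}$. The notation $X\overset{1}{\hookrightarrow}Y$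 means that $X$ is a linear subspace of $Y$ and $\|x\|_Y\le\|x\|_X$ for every $x\in X$. *)

theory Defs
  imports "HOL-Analysis.Analysis"
begin

text \<open>
  The scalar field is an arbitrary type of class \<open>real_normed_field\<close>; its norm is multiplicative,
  so by the theorems of Mazur and Ostrowski it is isometrically isomorphic to the reals or to the
  complex numbers. The class \<open>banach\<close> only provides a real Banach space, and \<open>smul\<close> is the
  multiplication by scalars of the field. For real scalars, \<open>smul\<close> is necessarily \<open>scaleR\<close>.
\<close>

locale banach_space_over = vector_space smul
  for smul :: "'k::real_normed_field \<Rightarrow> 'e::banach \<Rightarrow> 'e" +
  assumes smul_of_real: "smul (of_real t) x = t *\<^sub>R x"
    and norm_smul: "norm (smul c x) = norm c * norm x"

text \<open>
  Elements of \<open>'e \<Rightarrow>\<^sub>L 'k\<close> are merely real-linear; the dual consists of the ones that are linear over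
  the scalar field. It carries the operator norm of \<open>'e \<Rightarrow>\<^sub>L 'k\<close>.
\<close>

definition dual_space :: "('k::real_normed_field \<Rightarrow> 'e::real_normed_vector \<Rightarrow> 'e) \<Rightarrow> ('e \<Rightarrow>\<^sub>L 'k) set"
  where "dual_space smul = {f. \<forall>c x. blinfun_apply f (smul c x) = c * blinfun_apply f x}"

definition dual_smul :: "'k::real_normed_field \<Rightarrow> ('e::real_normed_vector \<Rightarrow>\<^sub>L 'k) \<Rightarrow> ('e \<Rightarrow>\<^sub>L 'k)"
  where "dual_smul c f = blinfun_mult_right c o\<^sub>L f"

text \<open>
  The closed unit ball of the dual of a normed space whose underlying set is \<open>V\<close>. Since \<open>V\<close> may be
  a proper subset of the type (as \<open>dual_space\<close> is for complex scalars), functionals are represented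
  by total functions whose values outside \<open>V\<close> are irrelevant.
\<close>

definition dual_unit_ball ::
  "('k::real_normed_field \<Rightarrow> 'v::real_normed_vector \<Rightarrow> 'v) \<Rightarrow> 'v set \<Rightarrow> ('v \<Rightarrow> 'k) set"
  where "dual_unit_ball smul V = {\<phi>.
    (\<forall>x\<in>V. \<forall>y\<in>V. \<phi> (x + y) = \<phi> x + \<phi> y) \<and>
    (\<forall>c. \<forall>x\<in>V. \<phi> (smul c x) = c * \<phi> x) \<and>
    (\<forall>x\<in>V. norm (\<phi> x) \<le> norm x)}"

definition weakly_summable ::
  "('k::real_normed_field \<Rightarrow> 'v::real_normed_vector \<Rightarrow> 'v) \<Rightarrow> 'v set \<Rightarrow> real \<Rightarrow> (nat \<Rightarrow> 'v) set"
  where "weakly_summable smul V p = {x. (\<forall>j. x j \<in> V) \<and>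
    (\<forall>\<phi>\<in>dual_unit_ball smul V. summable (\<lambda>j. norm (\<phi> (x j)) powr p)) \<and>
    bdd_above ((\<lambda>\<phi>. (\<Sum>j. norm (\<phi> (x j)) powr p) powr (1 / p)) ` dual_unit_ball smul V)}"

definition weak_norm ::
  "('k::real_normed_field \<Rightarrow> 'v::real_normed_vector \<Rightarrow> 'v) \<Rightarrow> 'v set \<Rightarrow> real \<Rightarrow> (nat \<Rightarrow> 'v) \<Rightarrow> real"
  where "weak_norm smul V p x =
    (SUP \<phi>\<in>dual_unit_ball smul V. (\<Sum>j. norm (\<phi> (x j)) powr p) powr (1 / p))"

definition dual_weakly_summable ::
  "('k::real_normed_field \<Rightarrow> 'e::real_normed_vector \<Rightarrow> 'e) \<Rightarrow> real \<Rightarrow> (nat \<Rightarrow> 'e \<Rightarrow>\<^sub>L 'k) set"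
  where "dual_weakly_summable smul p = weakly_summable dual_smul (dual_space smul) p"

text \<open>
  The inner series below converges for every weakly summable \<open>f\<close>, because evaluation at \<open>x j\<close> is a
  bounded functional on the dual. Thus only the outer series imposes a condition on \<open>x\<close>.
\<close>

definition mid_summable ::
  "('k::real_normed_field \<Rightarrow> 'e::real_normed_vector \<Rightarrow> 'e) \<Rightarrow> real \<Rightarrow> real \<Rightarrow> (nat \<Rightarrow> 'e) set"
  where "mid_summable smul q p = {x. \<forall>f\<in>dual_weakly_summable smul p.
    summable (\<lambda>j. (\<Sum>n. norm (blinfun_apply (f n) (x j)) powr p) powr (q / p))}"

text \<open>
  For \<open>x\<close> in \<open>mid_summable smul q p\<close> with \<open>p, q \<ge> 1\<close> the supremum is over a bounded nonempty set:
  otherwise suitable multiples of elements of the ball could be interleaved to a weakly summable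
  sequence whose outer series diverges.
\<close>

definition mid_norm ::
  "('k::real_normed_field \<Rightarrow> 'e::real_normed_vector \<Rightarrow> 'e) \<Rightarrow> real \<Rightarrow> real \<Rightarrow> (nat \<Rightarrow> 'e) \<Rightarrow> real"
  where "mid_norm smul q p x =
    (SUP f\<in>{f \<in> dual_weakly_summable smul p. weak_norm dual_smul (dual_space smul) p f \<le> 1}.
      (\<Sum>j. (\<Sum>n. norm (blinfun_apply (f n) (x j)) powr p) powr (q / p)) powr (1 / q))"

definition sequence_subspace ::
  "('k::real_normed_field \<Rightarrow> 'e::real_normed_vector \<Rightarrow> 'e) \<Rightarrow> (nat \<Rightarrow> 'e) set \<Rightarrow> bool"
  where "sequence_subspace smul X \<longleftrightarrow> (\<lambda>j. 0) \<in> X \<and>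
    (\<forall>x\<in>X. \<forall>y\<in>X. (\<lambda>j. x j + y j) \<in> X) \<and> (\<forall>c. \<forall>x\<in>X. (\<lambda>j. smul c (x j)) \<in> X)"

definition norm_one_embedded ::
  "('k::real_normed_field \<Rightarrow> 'e::real_normed_vector \<Rightarrow> 'e) \<Rightarrow>
    (nat \<Rightarrow> 'e) set \<Rightarrow> ((nat \<Rightarrow> 'e) \<Rightarrow> real) \<Rightarrow> (nat \<Rightarrow> 'e) set \<Rightarrow> ((nat \<Rightarrow> 'e) \<Rightarrow> real) \<Rightarrow> bool"
  where "norm_one_embedded smul X norm\<^sub>X Y norm\<^sub>Y \<longleftrightarrow>
    sequence_subspace smul X \<and> sequence_subspace smul Y \<and> X \<subseteq> Y \<and>
    (\<forall>x\<in>X. norm\<^sub>Y x \<le> norm\<^sub>X x)"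

end

theory Submission imports Defs begin

text \<open>
  Let \<open>x\<close> be mid \<open>(q, p)\<close>-summable with norm \<open>C\<close>, and let \<open>f\<close> be in the unit ball of
  \<open>\<ell>\<^sub>s\<^sup>w(E\<^sup>*)\<close>. Put \<open>u = s / p\<close>, and let \<open>b\<^sub>n = \<Sum>\<^sub>j |f\<^sub>n(x\<^sub>j)|\<^sup>p\<close>. The proof tests \<open>x\<close> against multiples of the \<open>f\<^sub>n\<close>. If \<open>w \<ge> 0\<close> is in the unit
  ball of \<open>\<ell>\<^sub>u\<^sub>'\<close>, where \<open>u'\<close> is conjugate to \<open>u\<close>, then by Hoelder's inequality the
  \<open>w\<^sub>n\<close>-weighted sum of the \<open>|\<phi>(f\<^sub>n)|\<^sup>p\<close> is at most one, so that the sequence of the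
  \<open>w\<^sub>n\<^bsup>1/p\<^esup> f\<^sub>n\<close> belongs to the unit ball of \<open>\<ell>\<^sub>p\<^sup>w(E\<^sup>*)\<close>. Since \<open>q \<le> p\<close>, the norm of \<open>\<ell>\<^sub>1\<close> is
  bounded by the one of \<open>\<ell>\<^bsub>q/p\<^esub>\<close>, and the hypothesis on \<open>x\<close> yields \<open>\<Sum>\<^sub>n w\<^sub>n b\<^sub>n \<le> C\<^sup>p\<close>. The duality of
  \<open>\<ell>\<^sub>u\<close> and \<open>\<ell>\<^sub>u\<^sub>'\<close> (\<open>norming_weights\<close>) turns this into \<open>\<Sum>\<^sub>n b\<^sub>n\<^sup>u \<le> C\<^sup>s\<close>. As \<open>u \<ge> 1\<close>, powers with exponent \<open>u\<close>
  are superadditive, and therefore \<open>\<Sum>\<^sub>j \<Sum>\<^sub>n |f\<^sub>n(x\<^sub>j)|\<^sup>s \<le> C\<^sup>s\<close> (\<open>double_sum_estimate\<close>). Finally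
  \<open>r / s \<ge> 1\<close>, and the same superadditivity gives the bound \<open>C\<^sup>r\<close> for the outer sum of exponent
  \<open>r / s\<close> (\<open>outer_sum_estimate\<close>).

  All these estimates are made for finite partial sums. They need \<open>C\<close> to be an upper bound for the
  outer sums over the unit ball, whereas mid summability only says that each of them is finite.
  The passage from finiteness to boundedness is a gliding hump argument (\<open>mid_summable_bounded\<close>).
\<close>

section \<open>Powers of finite sums\<close>

text \<open>
  The inequality between the norms of \<open>\<ell>\<^sub>u\<close> and \<open>\<ell>\<^sub>1\<close>: with \<open>S\<close> the sum of the \<open>c\<^sub>i\<close>, each term
  \<open>c\<^sub>i powr u\<close> is at most \<open>c\<^sub>i * S powr (u - 1)\<close>.
\<close>

lemma sum_powr_le_powr_sum:
  fixes c :: "'i \<Rightarrow> real"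
  assumes "finite A" "\<And>i. i \<in> A \<Longrightarrow> 0 \<le> c i" "1 \<le> u"
  shows "(\<Sum>i\<in>A. c i powr u) \<le> (\<Sum>i\<in>A. c i) powr u"
proof (cases "(\<Sum>i\<in>A. c i) = 0")
  case True
  then have "\<forall>i\<in>A. c i = 0" using assms by (simp add: sum_nonneg_eq_0_iff)
  then show ?thesis by simp
next
  case False
  define S where "S = (\<Sum>i\<in>A. c i)"
  have S: "S > 0" using False assms sum_nonneg[of A c] unfolding S_def by (smt (verit))
  have split: "t powr u = t * t powr (u - 1)" if "0 \<le> t" for t :: real
  proof (cases "t = 0")
    case False
    then have "t powr 1 * t powr (u - 1) = t powr u" by (simp only: powr_add[symmetric]) simp
    then show ?thesis using that by simp
  qed simp
  have "(\<Sum>i\<in>A. c i powr u) \<le> (\<Sum>i\<in>A. c i * S powr (u - 1))"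
  proof (rule sum_mono)
    fix i assume i: "i \<in> A"
    have "c i \<le> S" unfolding S_def using assms i by (intro member_le_sum) auto
    then have "c i powr (u - 1) \<le> S powr (u - 1)"
      using assms i by (intro powr_mono2) auto
    then have "c i * c i powr (u - 1) \<le> c i * S powr (u - 1)"
      using assms i by (intro mult_left_mono) auto
    then show "c i powr u \<le> c i * S powr (u - 1)"
      using split[of "c i"] assms i by simp
  qed
  also have "\<dots> = S * S powr (u - 1)" by (simp add: S_def sum_distrib_right)
  also have "\<dots> = S powr u" using split[of S] S by simp
  finally show ?thesis by (simp add: S_def)
qed

lemma powr_add_le:
  fixes a b u :: real
  assumes "0 \<le> a" "0 \<le> b" "0 \<le> u"
  shows "(a + b) powr u \<le> 2 powr u * (a powr u + b powr u)"
proof -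
  have "(a + b) powr u \<le> (2 * max a b) powr u"
    using assms by (intro powr_mono2) auto
  also have "\<dots> = 2 powr u * max a b powr u" using assms by (simp add: powr_mult)
  also have "\<dots> \<le> 2 powr u * (a powr u + b powr u)"
    by (intro mult_left_mono) (auto simp: max_def)
  finally show ?thesis .
qed

text \<open>
  This is the duality of the finite-dimensional spaces \<open>\<ell>\<^sub>u\<close> and \<open>\<ell>\<^sub>u\<^sub>'\<close> with \<open>1/u + 1/u' = 1\<close>: some
  functional \<open>w\<close> of norm at most one attains the norm of \<open>b\<close>. It is \<open>(b / \<parallel>b\<parallel>) powr (u - 1)\<close>, and
  its norm is estimated by the weighted inequality between the arithmetic and geometric means.
\<close>

lemma norming_weights:
  fixes b :: "'i \<Rightarrow> real"
  assumes A: "finite A" and b: "\<And>i. i \<in> A \<Longrightarrow> 0 \<le> b i" and u: "1 \<le> u"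
  shows "\<exists>w. (\<forall>i. 0 \<le> w i) \<and>
    (\<forall>d. (\<forall>i\<in>A. 0 \<le> d i) \<and> (\<Sum>i\<in>A. d i powr u) \<le> 1 \<longrightarrow> (\<Sum>i\<in>A. w i * d i) \<le> 1) \<and>
    (\<Sum>i\<in>A. w i * b i) = (\<Sum>i\<in>A. b i powr u) powr (1 / u)"
proof (cases "(\<Sum>i\<in>A. b i powr u) = 0")
  case True
  show ?thesis
    by (rule exI[of _ "\<lambda>i. 0"]) (auto simp: True)
next
  case False
  define B where "B = (\<Sum>i\<in>A. b i powr u)"
  define \<beta> where "\<beta> = B powr (1 / u)"
  have "0 \<le> B" unfolding B_def by (intro sum_nonneg) auto
  then have B: "0 < B" using False by (simp add: B_def)
  then have \<beta>: "0 < \<beta>" by (simp add: \<beta>_def)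
  have \<beta>u: "\<beta> powr u = B" using B u by (simp add: \<beta>_def powr_powr)
  define e where "e i = b i / \<beta>" for i
  have e: "0 \<le> e i" if "i \<in> A" for i using b[OF that] \<beta> by (simp add: e_def)
  have e1: "(\<Sum>i\<in>A. e i powr u) = 1"
  proof -
    have "(\<Sum>i\<in>A. e i powr u) = (\<Sum>i\<in>A. b i powr u / B)"
      using \<beta> b by (intro sum.cong) (auto simp: e_def powr_divide \<beta>u)
    also have "\<dots> = 1" using B by (simp add: B_def sum_divide_distrib[symmetric])
    finally show ?thesis .
  qed
  have young: "e i powr (u - 1) * t \<le> (u - 1) / u * e i powr u + 1 / u * t powr u"
    if "i \<in> A" "0 \<le> t" for i t
  proof (cases "e i = 0 \<or> t = 0")
    case True
    then show ?thesis using u by auto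
  next
    case False
    then have "e i > 0" "t > 0" using e[OF that(1)] that by auto
    moreover have "(u - 1) / u + 1 / u = 1" using u by (simp add: field_simps)
    ultimately have "(e i powr u) powr ((u - 1) / u) * (t powr u) powr (1 / u)
        \<le> (u - 1) / u * e i powr u + 1 / u * t powr u"
      using u by (intro Youngs_inequality_0) auto
    then show ?thesis using u \<open>t > 0\<close> by (simp add: powr_powr)
  qed
  show ?thesis
  proof (intro exI[of _ "\<lambda>i. e i powr (u - 1)"] conjI allI impI)
    fix d :: "'i \<Rightarrow> real"
    assume d: "(\<forall>i\<in>A. 0 \<le> d i) \<and> (\<Sum>i\<in>A. d i powr u) \<le> 1"
    have "(\<Sum>i\<in>A. e i powr (u - 1) * d i)
        \<le> (\<Sum>i\<in>A. (u - 1) / u * e i powr u + 1 / u * d i powr u)"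
      using d by (intro sum_mono young) auto
    also have "\<dots> = (u - 1) / u * (\<Sum>i\<in>A. e i powr u) + 1 / u * (\<Sum>i\<in>A. d i powr u)"
      by (simp only: sum.distrib sum_distrib_left)
    also have "\<dots> \<le> (u - 1) / u * 1 + 1 / u * 1"
      using e1 d u by (intro add_mono mult_left_mono) auto
    also have "\<dots> = 1" using u by (simp add: field_simps)
    finally show "(\<Sum>i\<in>A. e i powr (u - 1) * d i) \<le> 1" .
  next
    have "(\<Sum>i\<in>A. e i powr (u - 1) * b i) = (\<Sum>i\<in>A. \<beta> * e i powr u)"
    proof (rule sum.cong)
      fix i assume i: "i \<in> A"
      show "e i powr (u - 1) * b i = \<beta> * e i powr u"
      proof (cases "e i = 0")
        case False
        then have "e i > 0" using e[OF i] by simp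
        then have "e i powr u = e i powr (u - 1) * e i" by (simp add: powr_diff)
        moreover have "b i = \<beta> * e i" using \<beta> by (simp add: e_def)
        ultimately show ?thesis by simp
      qed simp
    qed simp
    also have "\<dots> = \<beta>" by (simp add: sum_distrib_left[symmetric] e1)
    finally show "(\<Sum>i\<in>A. e i powr (u - 1) * b i) = (\<Sum>i\<in>A. b i powr u) powr (1 / u)"
      by (simp add: \<beta>_def B_def)
  qed simp
qed

section \<open>The unit ball of weakly summable sequences in the dual\<close>

lemma dual_smul_apply [simp]: "blinfun_apply (dual_smul c f) x = c * blinfun_apply f x"
  by (simp add: dual_smul_def blinfun_mult_right.rep_eq)

lemma dual_smul_in_dual_space: "f \<in> dual_space smul \<Longrightarrow> dual_smul c f \<in> dual_space smul"
  by (simp add: dual_space_def mult.left_commute)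

lemma dual_unit_ball_dual_smul:
  assumes "\<phi> \<in> dual_unit_ball dual_smul (dual_space smul)" "f \<in> dual_space smul"
  shows "\<phi> (dual_smul c f) = c * \<phi> f"
  using assms by (simp add: dual_unit_ball_def)

lemma zero_in_dual_unit_ball: "(\<lambda>x. 0) \<in> dual_unit_ball smul V"
  by (simp add: dual_unit_ball_def)

lemma evaluation_in_dual_unit_ball:
  assumes "norm x \<le> 1"
  shows "(\<lambda>f. blinfun_apply f x) \<in> dual_unit_ball dual_smul (dual_space smul)"
  using assms
  by (auto simp: dual_unit_ball_def blinfun.add_left
      intro!: order_trans[OF norm_blinfun mult_left_le])

text \<open>
  Finite partial sums describe the unit ball of \<open>\<ell>\<^sub>p\<^sup>w(E\<^sup>*)\<close> without mentioning convergence.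
\<close>

definition weak_ball ::
  "('k::real_normed_field \<Rightarrow> 'e::real_normed_vector \<Rightarrow> 'e) \<Rightarrow> real \<Rightarrow> (nat \<Rightarrow> 'e \<Rightarrow>\<^sub>L 'k) set"
  where "weak_ball smul p = {f. (\<forall>n. f n \<in> dual_space smul) \<and>
    (\<forall>\<phi>\<in>dual_unit_ball dual_smul (dual_space smul). \<forall>N. (\<Sum>n<N. norm (\<phi> (f n)) powr p) \<le> 1)}"

lemma zero_in_weak_ball:
  fixes smul :: "'k::real_normed_field \<Rightarrow> 'e::real_normed_vector \<Rightarrow> 'e"
  shows "(\<lambda>n. 0) \<in> weak_ball smul p"
proof -
  have V: "0 \<in> dual_space smul" by (simp add: dual_space_def)
  have "(\<Sum>n<N. norm (\<phi> 0) powr p) \<le> 1"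
    if "\<phi> \<in> dual_unit_ball dual_smul (dual_space smul)" for \<phi> N
  proof -
    have "norm (\<phi> 0) \<le> norm (0 :: 'e \<Rightarrow>\<^sub>L 'k)"
      using that V unfolding dual_unit_ball_def by blast
    then show ?thesis by simp
  qed
  then show ?thesis using V by (simp only: weak_ball_def) blast
qed

lemma weak_ball_suminf:
  assumes f: "f \<in> weak_ball smul p" and \<phi>: "\<phi> \<in> dual_unit_ball dual_smul (dual_space smul)"
  shows "summable (\<lambda>n. norm (\<phi> (f n)) powr p)" "(\<Sum>n. norm (\<phi> (f n)) powr p) \<le> 1"
proof -
  have le: "(\<Sum>n<N. norm (\<phi> (f n)) powr p) \<le> 1" for N
    using f \<phi> by (simp add: weak_ball_def)
  show "summable (\<lambda>n. norm (\<phi> (f n)) powr p)"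
    by (rule summableI_nonneg_bounded[OF _ le]) simp
  then show "(\<Sum>n. norm (\<phi> (f n)) powr p) \<le> 1"
    using le by (rule suminf_le_const)
qed

lemma weak_ball_eq:
  assumes p: "0 < p"
  shows "{f \<in> dual_weakly_summable smul p. weak_norm dual_smul (dual_space smul) p f \<le> 1}
    = weak_ball smul p" (is "?L = _")
proof (intro equalityI subsetI)
  fix f assume "f \<in> ?L"
  then have V: "\<And>j. f j \<in> dual_space smul"
    and sm: "\<And>\<phi>. \<phi> \<in> dual_unit_ball dual_smul (dual_space smul) \<Longrightarrow>
      summable (\<lambda>n. norm (\<phi> (f n)) powr p)"
    and bdd: "bdd_above ((\<lambda>\<phi>. (\<Sum>j. norm (\<phi> (f j)) powr p) powr (1 / p))
      ` dual_unit_ball dual_smul (dual_space smul))"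
    and le: "weak_norm dual_smul (dual_space smul) p f \<le> 1"
    by (auto simp: dual_weakly_summable_def weakly_summable_def)
  have "(\<Sum>n<N. norm (\<phi> (f n)) powr p) \<le> 1"
    if \<phi>: "\<phi> \<in> dual_unit_ball dual_smul (dual_space smul)" for \<phi> N
  proof -
    let ?S = "\<Sum>j. norm (\<phi> (f j)) powr p"
    have nn: "0 \<le> ?S" by (intro suminf_nonneg sm \<phi>) simp
    have "?S powr (1 / p) \<le> 1"
      using cSUP_upper[OF \<phi> bdd] le by (simp add: weak_norm_def)
    then have "(?S powr (1 / p)) powr p \<le> 1"
      using p powr_mono2[of p "?S powr (1 / p)" 1] by simp
    then have "?S \<le> 1" using p nn by (simp add: powr_powr)
    moreover have "(\<Sum>n<N. norm (\<phi> (f n)) powr p) \<le> ?S"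
      by (intro sum_le_suminf sm \<phi>) auto
    ultimately show ?thesis by linarith
  qed
  then show "f \<in> weak_ball smul p" using V by (simp add: weak_ball_def)
next
  fix f assume f: "f \<in> weak_ball smul p"
  have le: "(\<Sum>j. norm (\<phi> (f j)) powr p) powr (1 / p) \<le> 1"
    if "\<phi> \<in> dual_unit_ball dual_smul (dual_space smul)" for \<phi>
    using powr_mono2[of "1 / p" "\<Sum>j. norm (\<phi> (f j)) powr p" 1] p weak_ball_suminf[OF f that]
    by (simp add: suminf_nonneg)
  have "weak_norm dual_smul (dual_space smul) p f \<le> 1"
    unfolding weak_norm_def using zero_in_dual_unit_ball le by (intro cSUP_least) auto
  moreover have "f \<in> dual_weakly_summable smul p"
    using weak_ball_suminf[OF f] f le
    by (auto simp: dual_weakly_summable_def weakly_summable_def weak_ball_def intro!: bdd_aboveI2)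
  ultimately show "f \<in> ?L" by simp
qed

text \<open>
  Summability conditions, which quantify over all weakly summable sequences, thereby reduce to
  the unit ball.
\<close>

lemma weakly_summable_scale_into_ball:
  assumes p: "0 < p" and f: "f \<in> dual_weakly_summable smul p"
  obtains c where "0 < c" "(\<lambda>n. dual_smul (of_real c) (f n)) \<in> weak_ball smul p"
proof -
  let ?D = "dual_unit_ball dual_smul (dual_space smul)"
  have V: "\<And>j. f j \<in> dual_space smul"
    and sm: "\<And>\<phi>. \<phi> \<in> ?D \<Longrightarrow> summable (\<lambda>n. norm (\<phi> (f n)) powr p)"
    using f by (auto simp: dual_weakly_summable_def weakly_summable_def)
  obtain M' where M': "\<And>\<phi>. \<phi> \<in> ?D \<Longrightarrow> (\<Sum>j. norm (\<phi> (f j)) powr p) powr (1 / p) \<le> M'"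
    using f by (auto simp: dual_weakly_summable_def weakly_summable_def bdd_above_def)
  \<comment> \<open>The reciprocal of \<open>M\<close> is the factor, and the bound \<open>M'\<close> may be zero.\<close>
  define M where "M = max M' 1"
  have M: "0 < M" "\<And>\<phi>. \<phi> \<in> ?D \<Longrightarrow> (\<Sum>j. norm (\<phi> (f j)) powr p) powr (1 / p) \<le> M"
    using M' by (auto simp: M_def intro: max.coboundedI1)
  show ?thesis
  proof (rule that[of "1 / M"])
    have "(\<Sum>n<N. norm (\<phi> (dual_smul (of_real (1 / M)) (f n))) powr p) \<le> 1"
      if \<phi>: "\<phi> \<in> ?D" for \<phi> N
    proof -
      let ?S = "\<Sum>j. norm (\<phi> (f j)) powr p"
      have nn: "0 \<le> ?S" by (intro suminf_nonneg sm \<phi>) simp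
      have "(?S powr (1 / p)) powr p \<le> M powr p"
        using M(2)[OF \<phi>] p by (intro powr_mono2) auto
      then have "?S \<le> M powr p" using p nn by (simp add: powr_powr)
      moreover have "(\<Sum>n<N. norm (\<phi> (f n)) powr p) \<le> ?S"
        by (intro sum_le_suminf sm \<phi>) auto
      ultimately have "(\<Sum>n<N. norm (\<phi> (f n)) powr p) / M powr p \<le> 1"
        using M(1) by simp
      moreover have "norm (\<phi> (dual_smul (of_real (1 / M)) (f n))) powr p
          = norm (\<phi> (f n)) powr p / M powr p" for n
        using M(1) by (simp add: dual_unit_ball_dual_smul[OF \<phi> V] norm_mult norm_divide powr_divide)
      ultimately show ?thesis by (simp add: sum_divide_distrib)
    qed
    then show "(\<lambda>n. dual_smul (of_real (1 / M)) (f n)) \<in> weak_ball smul p"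
      using V by (simp add: weak_ball_def dual_smul_in_dual_space)
  qed (use M in simp)
qed

section \<open>Mid summable sequences tested on the unit ball\<close>

definition inner_sum ::
  "real \<Rightarrow> (nat \<Rightarrow> 'e::real_normed_vector \<Rightarrow>\<^sub>L 'k::real_normed_field) \<Rightarrow> 'e \<Rightarrow> real"
  where "inner_sum p f x = (\<Sum>n. norm (blinfun_apply (f n) x) powr p)"

text \<open>
  Evaluation at a normalised vector is a member of the unit ball of the bidual.
\<close>

lemma weak_ball_summable_apply:
  assumes f: "f \<in> weak_ball smul p"
  shows "summable (\<lambda>n. norm (blinfun_apply (f n) x) powr p)"
proof (cases "x = 0")
  case False
  let ?y = "(1 / norm x) *\<^sub>R x"
  have "summable (\<lambda>n. norm (blinfun_apply (f n) ?y) powr p)"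
    using weak_ball_suminf(1)[OF f evaluation_in_dual_unit_ball[of ?y]] False by simp
  then have "summable (\<lambda>n. norm x powr p * norm (blinfun_apply (f n) ?y) powr p)"
    by (rule summable_mult)
  moreover have "norm x powr p * norm (blinfun_apply (f n) ?y) powr p
      = norm (blinfun_apply (f n) x) powr p" for n
    using False by (simp add: blinfun.scaleR_right powr_mult[symmetric] del: inverse_eq_divide)
  ultimately show ?thesis by simp
qed (simp add: blinfun.zero_right)

lemma inner_sum_nonneg:
  "f \<in> weak_ball smul p \<Longrightarrow> 0 \<le> inner_sum p f x"
  unfolding inner_sum_def by (intro suminf_nonneg weak_ball_summable_apply) auto

lemma inner_sum_dual_smul:
  assumes "summable (\<lambda>n. norm (blinfun_apply (f n) x) powr p)"
  shows "inner_sum p (\<lambda>n. dual_smul c (f n)) x = norm c powr p * inner_sum p f x"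
  using suminf_mult[OF assms] by (simp add: inner_sum_def norm_mult powr_mult)

lemma scaled_into_ball_summable_apply:
  assumes "0 < c" "(\<lambda>n. dual_smul (of_real c :: 'k::real_normed_field) (f n)) \<in> weak_ball smul p"
  shows "summable (\<lambda>n. norm (blinfun_apply (f n) x) powr p)"
proof -
  have "summable (\<lambda>n. c powr p * norm (blinfun_apply (f n) x) powr p)"
    using weak_ball_summable_apply[OF assms(2), of x] assms(1) by (simp add: norm_mult powr_mult)
  then show ?thesis using assms(1) by (simp add: summable_cmult_iff)
qed

lemma mid_summable_iff:
  assumes p: "0 < p"
  shows "x \<in> mid_summable smul q p \<longleftrightarrow>
    (\<forall>f\<in>weak_ball smul p. summable (\<lambda>j. inner_sum p f (x j) powr (q / p)))" (is "_ \<longleftrightarrow> ?R")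
proof
  assume "x \<in> mid_summable smul q p"
  then show ?R
    using weak_ball_eq[OF p, of smul] by (auto simp: mid_summable_def inner_sum_def)
next
  assume R: ?R
  have "summable (\<lambda>j. inner_sum p f (x j) powr (q / p))"
    if f: "f \<in> dual_weakly_summable smul p" for f
  proof -
    obtain c where c: "0 < c" "(\<lambda>n. dual_smul (of_real c) (f n)) \<in> weak_ball smul p"
      using weakly_summable_scale_into_ball[OF p f] by blast
    have "summable (\<lambda>j. (c powr p * inner_sum p f (x j)) powr (q / p))"
      using bspec[OF R c(2)] c(1)
      by (simp add: inner_sum_dual_smul[OF scaled_into_ball_summable_apply[OF c]])
    moreover have "0 \<le> inner_sum p f (x j)" for j
      unfolding inner_sum_def by (intro suminf_nonneg scaled_into_ball_summable_apply[OF c]) auto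
    ultimately have "summable (\<lambda>j. (c powr p) powr (q / p) * inner_sum p f (x j) powr (q / p))"
      by (simp add: powr_mult)
    then show ?thesis using c(1) by (simp add: summable_cmult_iff)
  qed
  then show "x \<in> mid_summable smul q p" by (simp add: mid_summable_def inner_sum_def)
qed

lemma mid_norm_eq:
  assumes "0 < p"
  shows "mid_norm smul q p x =
    (SUP f\<in>weak_ball smul p. (\<Sum>j. inner_sum p f (x j) powr (q / p)) powr (1 / q))"
  by (simp add: mid_norm_def weak_ball_eq[OF assms] inner_sum_def)

lemma sequence_subspace_mid_summable:
  assumes p: "0 < p" and q: "0 < q"
  shows "sequence_subspace smul (mid_summable smul q p)"
  unfolding sequence_subspace_def
proof (intro conjI ballI allI)
  show "(\<lambda>j. 0) \<in> mid_summable smul q p"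
    by (simp add: mid_summable_def)
next
  fix x y assume x: "x \<in> mid_summable smul q p" and y: "y \<in> mid_summable smul q p"
  show "(\<lambda>j. x j + y j) \<in> mid_summable smul q p"
    unfolding mid_summable_iff[OF p]
  proof
    fix f assume f: "f \<in> weak_ball smul p"
    let ?I = "inner_sum p f"
    note sm = weak_ball_summable_apply[OF f]
    have inner: "?I (a + b) \<le> 2 powr p * (?I a + ?I b)" for a b
    proof -
      have "?I (a + b) \<le> (\<Sum>n. 2 powr p * (norm (blinfun_apply (f n) a) powr p
          + norm (blinfun_apply (f n) b) powr p))"
        unfolding inner_sum_def
      proof (intro suminf_le sm summable_mult summable_add)
        fix n
        have "norm (blinfun_apply (f n) (a + b)) powr p
            \<le> (norm (blinfun_apply (f n) a) + norm (blinfun_apply (f n) b)) powr p"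
          using p by (intro powr_mono2) (auto simp: blinfun.add_right norm_triangle_ineq)
        also have "\<dots> \<le> 2 powr p * (norm (blinfun_apply (f n) a) powr p
            + norm (blinfun_apply (f n) b) powr p)"
          using p by (intro powr_add_le) auto
        finally show "norm (blinfun_apply (f n) (a + b)) powr p \<le> \<dots>" .
      qed
      also have "\<dots> = 2 powr p * (?I a + ?I b)"
        unfolding inner_sum_def by (subst suminf_add[OF sm sm]) (intro suminf_mult summable_add sm)
      finally show ?thesis .
    qed
    have bound: "(?I (x j + y j)) powr (q / p) \<le> (2 powr p) powr (q / p) * (2 powr (q / p)
        * (?I (x j) powr (q / p) + ?I (y j) powr (q / p)))" for j
    proof -
      have "(?I (x j + y j)) powr (q / p) \<le> (2 powr p * (?I (x j) + ?I (y j))) powr (q / p)"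
        using p q inner inner_sum_nonneg[OF f] by (intro powr_mono2) auto
      also have "\<dots> = (2 powr p) powr (q / p) * (?I (x j) + ?I (y j)) powr (q / p)"
        using inner_sum_nonneg[OF f] by (simp add: powr_mult)
      also have "\<dots> \<le> (2 powr p) powr (q / p) * (2 powr (q / p)
          * (?I (x j) powr (q / p) + ?I (y j) powr (q / p)))"
        using p q inner_sum_nonneg[OF f] by (intro mult_left_mono powr_add_le) auto
      finally show ?thesis .
    qed
    have "summable (\<lambda>j. (2 powr p) powr (q / p) * (2 powr (q / p)
        * (?I (x j) powr (q / p) + ?I (y j) powr (q / p))))"
      using x y f by (intro summable_mult summable_add) (auto simp: mid_summable_iff[OF p])
    then show "summable (\<lambda>j. ?I (x j + y j) powr (q / p))"
      by (rule summable_comparison_test'[where N = 0]) (use bound in simp)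
  qed
next
  fix c x assume x: "x \<in> mid_summable smul q p"
  show "(\<lambda>j. smul c (x j)) \<in> mid_summable smul q p"
    unfolding mid_summable_iff[OF p]
  proof
    fix f assume f: "f \<in> weak_ball smul p"
    have "inner_sum p f (smul c a) = inner_sum p (\<lambda>n. dual_smul c (f n)) a" for a
      using f by (simp add: inner_sum_def weak_ball_def dual_space_def)
    then have "inner_sum p f (smul c a) powr (q / p)
        = (norm c powr p) powr (q / p) * inner_sum p f a powr (q / p)" for a
      using inner_sum_nonneg[OF f]
      by (simp add: inner_sum_dual_smul[OF weak_ball_summable_apply[OF f]] powr_mult)
    moreover have "summable (\<lambda>j. (norm c powr p) powr (q / p) * inner_sum p f (x j) powr (q / p))"
      using x f by (intro summable_mult) (auto simp: mid_summable_iff[OF p])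
    ultimately show "summable (\<lambda>j. inner_sum p f (smul c (x j)) powr (q / p))" by simp
  qed
qed

section \<open>Finiteness of the mid norm\<close>

text \<open>
  The sequences \<open>F k\<close>, damped by the factors \<open>2\<^bsup>-(k+1)\<^esup>\<close>, are merged into a single one by
  the enumeration of pairs. The damping keeps the result in the ball, because \<open>p \<ge> 1\<close> makes the
  factors \<open>2\<^bsup>-(k+1)p\<^esup>\<close> sum up to at most one.
\<close>

lemma interleave_in_weak_ball:
  assumes p: "1 \<le> p" and F: "\<And>k. F k \<in> weak_ball smul p"
  shows "(\<lambda>m. dual_smul (of_real ((1 / 2) ^ Suc (fst (prod_decode m))))
      (F (fst (prod_decode m)) (snd (prod_decode m)))) \<in> weak_ball smul p"
    (is "?g \<in> _")
proof -
  let ?D = "dual_unit_ball dual_smul (dual_space smul)"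
  have V: "F k n \<in> dual_space smul" for k n using F[of k] by (simp add: weak_ball_def)
  have "(\<Sum>m<N. norm (\<phi> (?g m)) powr p) \<le> 1" if \<phi>: "\<phi> \<in> ?D" for \<phi> N
  proof -
    let ?h = "\<lambda>(k, n). ((1 / 2) ^ Suc k) powr p * norm (\<phi> (F k n)) powr p"
    have scale: "norm (\<phi> (dual_smul (of_real c) (F k n))) powr p
        = c powr p * norm (\<phi> (F k n)) powr p" if "0 \<le> c" for c k n
      using that by (simp add: dual_unit_ball_dual_smul[OF \<phi> V] norm_mult powr_mult)
    have "(\<Sum>m<N. norm (\<phi> (?g m)) powr p) = (\<Sum>m<N. ?h (prod_decode m))"
      by (subst scale) (auto simp: case_prod_unfold)
    also have "\<dots> = sum ?h (prod_decode ` {..<N})"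
      by (simp add: sum.reindex[OF inj_on_subset[OF inj_prod_decode subset_UNIV]])
    also have "\<dots> \<le> sum ?h ({..<N} \<times> {..<N})"
    proof (rule sum_mono2)
      show "prod_decode ` {..<N} \<subseteq> {..<N} \<times> {..<N}"
      proof (clarify)
        fix k n m assume "(k, n) = prod_decode m" "m < N"
        then have "prod_encode (k, n) < N" by simp
        then show "k \<in> {..<N} \<and> n \<in> {..<N}"
          using le_prod_encode_1[of k n] le_prod_encode_2[of n k] by simp
      qed
    qed auto
    also have "\<dots> = (\<Sum>k<N. ((1 / 2) ^ Suc k) powr p * (\<Sum>n<N. norm (\<phi> (F k n)) powr p))"
      by (simp only: sum.cartesian_product[symmetric] sum_distrib_left)
    also have "\<dots> \<le> (\<Sum>k<N. (1 / 2) ^ Suc k * 1)"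
    proof (intro sum_mono mult_mono)
      fix k
      have "((1 / 2) ^ Suc k :: real) powr p \<le> ((1 / 2) ^ Suc k) powr 1"
        using p by (intro powr_mono') (auto intro!: power_le_one simp del: power_Suc)
      then show "((1 / 2) ^ Suc k :: real) powr p \<le> (1 / 2) ^ Suc k" by simp
      show "(\<Sum>n<N. norm (\<phi> (F k n)) powr p) \<le> 1"
        using F[of k] \<phi> by (simp add: weak_ball_def)
    qed (auto intro: sum_nonneg)
    also have "\<dots> = 1 - (1 / 2) ^ N"
      by (induction N) (auto simp: field_simps)
    also have "\<dots> \<le> (1 :: real)" by simp
    finally show ?thesis .
  qed
  then show ?thesis using V by (simp add: weak_ball_def dual_smul_in_dual_space)
qed

text \<open>
  Otherwise some \<open>F k\<close> in the ball have outer sums so large that, even after damping by \<open>a k\<close>,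
  they exceed \<open>k\<close>. The merged sequence \<open>g\<close> dominates every damped \<open>F k\<close>, so its outer sum exceeds
  every \<open>k\<close>, although it is finite.
\<close>

lemma mid_summable_bounded:
  assumes p: "1 \<le> p" and q: "0 < q" and x: "x \<in> mid_summable smul q p"
  obtains M where "\<And>f. f \<in> weak_ball smul p \<Longrightarrow> (\<Sum>j. inner_sum p f (x j) powr (q / p)) \<le> M"
proof (rule ccontr)
  have p0: "0 < p" using p by simp
  have sm: "summable (\<lambda>j. inner_sum p f (x j) powr (q / p))" if "f \<in> weak_ball smul p" for f
    using x that by (simp add: mid_summable_iff[OF p0])
  assume "\<not> thesis"
  then have "\<And>M. \<exists>f\<in>weak_ball smul p. M < (\<Sum>j. inner_sum p f (x j) powr (q / p))"
    using that by (meson not_le)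
  then obtain G where G: "\<And>M. G M \<in> weak_ball smul p"
    "\<And>M. M < (\<Sum>j. inner_sum p (G M) (x j) powr (q / p))"
    by metis
  define a :: "nat \<Rightarrow> real" where "a k = (1 / 2) ^ Suc k" for k
  have a: "0 < a k" for k by (simp add: a_def)
  \<comment> \<open>Damping by \<open>a k\<close> multiplies the outer sum, which has degree \<open>q\<close>, by \<open>a k powr q\<close>.\<close>
  define F where "F k = G (real k / a k powr q)" for k
  have F: "F k \<in> weak_ball smul p" for k by (simp add: F_def G)
  define g where "g = (\<lambda>m. dual_smul (of_real (a (fst (prod_decode m))))
      (F (fst (prod_decode m)) (snd (prod_decode m))))"
  have g: "g \<in> weak_ball smul p"
    unfolding g_def a_def by (rule interleave_in_weak_ball[OF p F])
  have inner: "a k powr p * inner_sum p (F k) y \<le> inner_sum p g y" for k y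
  proof -
    let ?t = "\<lambda>m. norm (blinfun_apply (g m) y) powr p"
    have "(\<Sum>n<N. a k powr p * norm (blinfun_apply (F k n) y) powr p) \<le> inner_sum p g y" for N
    proof -
      have "(\<Sum>n<N. a k powr p * norm (blinfun_apply (F k n) y) powr p)
          = (\<Sum>n<N. ?t (prod_encode (k, n)))"
        using a[of k] by (simp add: g_def norm_mult powr_mult)
      also have "\<dots> = sum ?t ((\<lambda>n. prod_encode (k, n)) ` {..<N})"
        by (subst sum.reindex) (auto simp: inj_on_def)
      also have "\<dots> \<le> inner_sum p g y"
        unfolding inner_sum_def by (intro sum_le_suminf weak_ball_summable_apply[OF g]) auto
      finally show ?thesis .
    qed
    then have "(\<Sum>n. a k powr p * norm (blinfun_apply (F k n) y) powr p) \<le> inner_sum p g y"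
      by (intro suminf_le_const summable_mult weak_ball_summable_apply[OF F])
    then show ?thesis
      by (simp add: inner_sum_def suminf_mult[OF weak_ball_summable_apply[OF F]])
  qed
  have outer: "real k \<le> (\<Sum>j. inner_sum p g (x j) powr (q / p))" for k
  proof -
    have "real k / a k powr q < (\<Sum>j. inner_sum p (F k) (x j) powr (q / p))"
      unfolding F_def by (rule G)
    then have "real k \<le> a k powr q * (\<Sum>j. inner_sum p (F k) (x j) powr (q / p))"
      using a[of k] by (simp add: field_simps)
    also have "\<dots> = (\<Sum>j. a k powr q * inner_sum p (F k) (x j) powr (q / p))"
      by (rule suminf_mult[OF sm[OF F], symmetric])
    also have "\<dots> \<le> (\<Sum>j. inner_sum p g (x j) powr (q / p))"
    proof (intro suminf_le summable_mult sm F g)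
      fix j
      have "a k powr q * inner_sum p (F k) (x j) powr (q / p)
          = (a k powr p * inner_sum p (F k) (x j)) powr (q / p)"
        using p0 a[of k] inner_sum_nonneg[OF F] by (simp add: powr_mult powr_powr)
      also have "\<dots> \<le> inner_sum p g (x j) powr (q / p)"
        using p0 q inner inner_sum_nonneg[OF F] by (intro powr_mono2) auto
      finally show "a k powr q * inner_sum p (F k) (x j) powr (q / p)
          \<le> inner_sum p g (x j) powr (q / p)" .
    qed
    finally show ?thesis .
  qed
  obtain k where "(\<Sum>j. inner_sum p g (x j) powr (q / p)) < real k"
    using reals_Archimedean2 by blast
  then show False using outer[of k] by linarith
qed

lemma outer_sum_le_mid_norm:
  assumes p: "1 \<le> p" and q: "0 < q" and x: "x \<in> mid_summable smul q p"
    and f: "f \<in> weak_ball smul p"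
  shows "(\<Sum>j. inner_sum p f (x j) powr (q / p)) powr (1 / q) \<le> mid_norm smul q p x"
proof -
  have p0: "0 < p" using p by simp
  obtain M where M: "\<And>f. f \<in> weak_ball smul p \<Longrightarrow> (\<Sum>j. inner_sum p f (x j) powr (q / p)) \<le> M"
    using mid_summable_bounded[OF p q x] by blast
  have "(\<Sum>j. inner_sum p h (x j) powr (q / p)) powr (1 / q) \<le> M powr (1 / q)"
    if h: "h \<in> weak_ball smul p" for h
    using M[OF h] q x h
    by (intro powr_mono2) (auto intro!: suminf_nonneg simp: mid_summable_iff[OF p0])
  then show ?thesis
    unfolding mid_norm_eq[OF p0] by (intro cSUP_upper f bdd_aboveI2)
qed

section \<open>The inclusion\<close>

text \<open>
  The assumption \<open>dual\<close> says that \<open>w\<close>, cut off at \<open>N\<close>, is in the unit ball of the dual of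
  \<open>\<ell>\<^sub>u\<close> with \<open>u = s / p\<close>. For \<open>\<phi>\<close> in the unit ball, it is applied to \<open>d\<^sub>n = |\<phi>(f\<^sub>n)|\<^sup>p\<close>, whose power
  with exponent \<open>u\<close> is \<open>|\<phi>(f\<^sub>n)|\<^sup>s\<close>.
\<close>

lemma weighted_weak_ball:
  assumes p: "0 < p" and s: "0 < s" and f: "f \<in> weak_ball smul s" and w: "\<And>n. 0 \<le> w n"
    and dual: "\<And>d. \<forall>n<N. 0 \<le> d n \<Longrightarrow> (\<Sum>n<N. d n powr (s / p)) \<le> 1 \<Longrightarrow>
      (\<Sum>n<N. w n * d n) \<le> 1"
  shows "(\<lambda>n. dual_smul (of_real (if n < N then w n powr (1 / p) else 0)) (f n)) \<in> weak_ball smul p"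
    (is "?g \<in> _")
proof -
  let ?D = "dual_unit_ball dual_smul (dual_space smul)"
  have V: "f n \<in> dual_space smul" for n using f by (simp add: weak_ball_def)
  have "(\<Sum>n<K. norm (\<phi> (?g n)) powr p) \<le> 1" if \<phi>: "\<phi> \<in> ?D" for \<phi> K
  proof -
    have eq: "norm (\<phi> (?g n)) powr p = (if n < N then w n * norm (\<phi> (f n)) powr p else 0)" for n
      using p w[of n] by (simp add: dual_unit_ball_dual_smul[OF \<phi> V] norm_mult powr_mult powr_powr)
    have "(\<Sum>n<K. norm (\<phi> (?g n)) powr p)
        = (\<Sum>n\<in>{..<K} \<inter> {..<N}. w n * norm (\<phi> (f n)) powr p)"
      unfolding eq by (simp add: sum.inter_restrict)
    also have "\<dots> \<le> (\<Sum>n<N. w n * norm (\<phi> (f n)) powr p)"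
      using w by (intro sum_mono2) auto
    also have "\<dots> \<le> 1"
    proof (rule dual)
      have "(\<Sum>n<N. norm (\<phi> (f n)) powr s) \<le> 1" using f \<phi> by (simp add: weak_ball_def)
      then show "(\<Sum>n<N. (norm (\<phi> (f n)) powr p) powr (s / p)) \<le> 1"
        using p by (simp add: powr_powr)
    qed simp
    finally show ?thesis .
  qed
  then show ?thesis using V by (simp add: weak_ball_def dual_smul_in_dual_space)
qed

text \<open>
  The core of the inclusion. The weights are chosen to norm the finite sequence \<open>b\<close> in \<open>\<ell>\<^bsub>s/p\<^esub>\<close>,
  so that testing \<open>x\<close> against the weighted sequence \<open>g\<close> bounds this norm of \<open>b\<close> by \<open>C\<^sup>p\<close>.
\<close>

lemma double_sum_estimate:
  fixes x :: "nat \<Rightarrow> 'e::real_normed_vector"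
  assumes q: "1 \<le> q" and qp: "q \<le> p" and ps: "p \<le> s" and C: "0 \<le> C"
    and x: "\<And>h. h \<in> weak_ball smul p \<Longrightarrow> (\<Sum>j<J. inner_sum p h (x j) powr (q / p)) \<le> C powr q"
    and f: "f \<in> weak_ball smul s"
  shows "(\<Sum>j<J. \<Sum>n<N. norm (blinfun_apply (f n) (x j)) powr s) \<le> C powr s"
proof -
  have p: "1 \<le> p" and u: "1 \<le> s / p" using q qp ps by auto
  define t where "t j n = norm (blinfun_apply (f n) (x j)) powr p" for j n
  define b where "b n = (\<Sum>j<J. t j n)" for n
  have b: "0 \<le> b n" for n unfolding b_def t_def by (intro sum_nonneg) auto
  obtain w where w: "\<forall>n. 0 \<le> w n"
    and dual: "\<forall>d. (\<forall>n\<in>{..<N}. 0 \<le> d n) \<and> (\<Sum>n<N. d n powr (s / p)) \<le> 1 \<longrightarrow>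
      (\<Sum>n<N. w n * d n) \<le> 1"
    and norming: "(\<Sum>n<N. w n * b n) = (\<Sum>n<N. b n powr (s / p)) powr (1 / (s / p))"
    using norming_weights[of "{..<N}" b "s / p", OF _ b u] by blast
  define g where "g n = dual_smul (of_real (if n < N then w n powr (1 / p) else 0)) (f n)" for n
  have g: "g \<in> weak_ball smul p"
    unfolding g_def using p ps by (intro weighted_weak_ball[OF _ _ f]) (use w dual in auto)
  have inner: "inner_sum p g (x j) = (\<Sum>n<N. w n * t j n)" for j
  proof -
    have "norm (blinfun_apply (g n) (x j)) powr p = (if n < N then w n * t j n else 0)" for n
      using p w by (simp add: g_def t_def norm_mult powr_mult powr_powr)
    then show ?thesis
      unfolding inner_sum_def by (subst suminf_finite[of "{..<N}"]) auto
  qed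
  have nn: "0 \<le> inner_sum p g (x j)" for j by (rule inner_sum_nonneg[OF g])
  have "(\<Sum>n<N. w n * b n) = (\<Sum>j<J. inner_sum p g (x j))"
    unfolding inner b_def sum_distrib_left by (rule sum.swap)
  also have "\<dots> = (\<Sum>j<J. (inner_sum p g (x j) powr (q / p)) powr (p / q))"
    using p q nn by (simp add: powr_powr)
  also have "\<dots> \<le> (\<Sum>j<J. inner_sum p g (x j) powr (q / p)) powr (p / q)"
    using q qp by (intro sum_powr_le_powr_sum) auto
  also have "\<dots> \<le> (C powr q) powr (p / q)"
    using q p x[OF g] by (intro powr_mono2) (auto intro: sum_nonneg)
  also have "\<dots> = C powr p" using q by (simp add: powr_powr)
  finally have "(\<Sum>n<N. b n powr (s / p)) powr (p / s) \<le> C powr p"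
    using norming by simp
  then have "((\<Sum>n<N. b n powr (s / p)) powr (p / s)) powr (s / p) \<le> (C powr p) powr (s / p)"
    using u by (intro powr_mono2) auto
  moreover have "0 \<le> (\<Sum>n<N. b n powr (s / p))" by (intro sum_nonneg) auto
  ultimately have *: "(\<Sum>n<N. b n powr (s / p)) \<le> C powr s"
    using p ps by (simp add: powr_powr)
  have "(\<Sum>j<J. \<Sum>n<N. norm (blinfun_apply (f n) (x j)) powr s)
      = (\<Sum>n<N. \<Sum>j<J. t j n powr (s / p))"
    using p by (subst sum.swap) (simp add: t_def powr_powr)
  also have "\<dots> \<le> (\<Sum>n<N. b n powr (s / p))"
    unfolding b_def using u by (intro sum_mono sum_powr_le_powr_sum) (auto simp: t_def)
  finally show ?thesis using * by linarith
qed

lemma outer_sum_estimate: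
  fixes x :: "nat \<Rightarrow> 'e::real_normed_vector"
  assumes q: "1 \<le> q" and qp: "q \<le> p" and ps: "p \<le> s" and sr: "s \<le> r" and C: "0 \<le> C"
    and x: "\<And>h. h \<in> weak_ball smul p \<Longrightarrow> (\<Sum>j<J. inner_sum p h (x j) powr (q / p)) \<le> C powr q"
    and f: "f \<in> weak_ball smul s"
  shows "(\<Sum>j<J. inner_sum s f (x j) powr (r / s)) \<le> C powr r"
proof -
  have s: "1 \<le> s" using q qp ps by simp
  note sm = weak_ball_summable_apply[OF f]
  have "(\<Sum>j<J. inner_sum s f (x j)) = (\<Sum>n. \<Sum>j<J. norm (blinfun_apply (f n) (x j)) powr s)"
    unfolding inner_sum_def by (intro suminf_sum[symmetric] sm)
  also have "\<dots> \<le> C powr s"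
  proof (intro suminf_le_const summable_sum sm)
    fix N
    show "(\<Sum>n<N. \<Sum>j<J. norm (blinfun_apply (f n) (x j)) powr s) \<le> C powr s"
      using double_sum_estimate[OF q qp ps C x f] by (subst sum.swap)
  qed
  finally have le: "(\<Sum>j<J. inner_sum s f (x j)) \<le> C powr s" .
  have "(\<Sum>j<J. inner_sum s f (x j) powr (r / s)) \<le> (\<Sum>j<J. inner_sum s f (x j)) powr (r / s)"
    using s sr inner_sum_nonneg[OF f] by (intro sum_powr_le_powr_sum) auto
  also have "\<dots> \<le> (C powr s) powr (r / s)"
    using le s sr inner_sum_nonneg[OF f] by (intro powr_mono2 sum_nonneg) auto
  also have "\<dots> = C powr r" using s by (simp add: powr_powr)
  finally show ?thesis .
qed

lemma mid_summable_embedded: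
  assumes q: "1 \<le> q" and qp: "q \<le> p" and ps: "p \<le> s" and sr: "s \<le> r"
  shows "norm_one_embedded smul
    (mid_summable smul q p) (mid_norm smul q p) (mid_summable smul r s) (mid_norm smul r s)"
proof -
  have p: "1 \<le> p" and s: "1 \<le> s" and r: "1 \<le> r" using q qp ps sr by auto
  have pos: "0 < p" "0 < q" "0 < s" "0 < r" using p q s r by auto
  have main: "x \<in> mid_summable smul r s \<and> mid_norm smul r s x \<le> mid_norm smul q p x"
    if x: "x \<in> mid_summable smul q p" for x
  proof -
    define C where "C = mid_norm smul q p x"
    have C: "0 \<le> C"
      using order_trans[OF powr_ge_zero outer_sum_le_mid_norm[OF p pos(2) x zero_in_weak_ball]]
      by (simp add: C_def)
    have xC: "(\<Sum>j<J. inner_sum p h (x j) powr (q / p)) \<le> C powr q"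
      if h: "h \<in> weak_ball smul p" for h J
    proof -
      let ?S = "\<Sum>j. inner_sum p h (x j) powr (q / p)"
      have sm: "summable (\<lambda>j. inner_sum p h (x j) powr (q / p))"
        using x h by (simp add: mid_summable_iff[OF pos(1)])
      have "(?S powr (1 / q)) powr q \<le> C powr q"
        using outer_sum_le_mid_norm[OF p pos(2) x h] pos by (intro powr_mono2) (auto simp: C_def)
      moreover have "0 \<le> ?S" using sm by (intro suminf_nonneg) auto
      moreover have "(\<Sum>j<J. inner_sum p h (x j) powr (q / p)) \<le> ?S"
        using sm by (intro sum_le_suminf) auto
      ultimately show ?thesis using pos by (simp add: powr_powr)
    qed
    have est: "(\<Sum>j<J. inner_sum s f (x j) powr (r / s)) \<le> C powr r"
      if "f \<in> weak_ball smul s" for f J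
      using outer_sum_estimate[OF q qp ps sr C xC that] .
    have sm: "summable (\<lambda>j. inner_sum s f (x j) powr (r / s))" if "f \<in> weak_ball smul s" for f
      using est[OF that] by (intro summableI_nonneg_bounded) auto
    have "mid_norm smul r s x \<le> C"
      unfolding mid_norm_eq[OF pos(3)]
    proof (rule cSUP_least)
      show "weak_ball smul s \<noteq> {}" using zero_in_weak_ball by blast
      fix f assume f: "f \<in> weak_ball smul s"
      let ?S = "\<Sum>j. inner_sum s f (x j) powr (r / s)"
      have "?S \<le> C powr r" using sm[OF f] est[OF f] by (rule suminf_le_const)
      moreover have "0 \<le> ?S" using sm[OF f] by (intro suminf_nonneg) auto
      ultimately have "?S powr (1 / r) \<le> (C powr r) powr (1 / r)"
        using pos by (intro powr_mono2) auto
      then show "?S powr (1 / r) \<le> C" using pos C by (simp add: powr_powr)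
    qed
    then show ?thesis using sm by (simp add: mid_summable_iff[OF pos(3)] C_def)
  qed
  then show ?thesis
    unfolding norm_one_embedded_def using pos
    by (auto intro: sequence_subspace_mid_summable)
qed

theorem proposition3p8:
  fixes smul :: "'k::real_normed_field \<Rightarrow> 'e::banach \<Rightarrow> 'e"
  assumes "banach_space_over smul"
  shows "(\<forall>q p r s :: real. 1 \<le> q \<and> 1 \<le> p \<and> 1 \<le> r \<and> 1 \<le> s \<and> q \<le> p \<and> p \<le> s \<and> s \<le> r \<longrightarrow>
      norm_one_embedded smul
        (mid_summable smul q p) (mid_norm smul q p)
        (mid_summable smul r s) (mid_norm smul r s)) \<and>
    (\<forall>p s :: real. 1 \<le> p \<and> p \<le> s \<longrightarrow>
      norm_one_embedded smul
        (mid_summable smul p p) (mid_norm smul p p)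
        (mid_summable smul s s) (mid_norm smul s s))"
  by (intro conjI allI impI mid_summable_embedded) auto

end
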